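(* Let $n \ge 2$. In All-but-one-delete Nim with $n$ heaps, the position $\langle z_1, z_2, \ldots, z_n \rangle$ (with $z_1,\ldots,z_n$ positive integers) is a $\mathcal{P}$-position if and only if for every $i \in \{1,\ldots,n\}$, the remainder of $z_i$ upon division by $n(n-1)$ lies between $1$ and $n-1$ (inclusive).
   Context: All-but-one-delete Nim with $n$ heaps: a position is an $n$-tuple $\langle z_1,\ldots,z_n\rangle$ of positive integers (heap sizes). Two players alternate moves. A move consists of selecting $n-1$ of the heaps and deleting them, and then splitting the one remaining heap into $n$ heaps, each containing at least one token (so the new position again consists of $n$ positive integers summing to the size of the kept heap). Normal play convention: a player who cannot move loses. A $\mathcal{P}$-position is a position from which the player about to move has no winning strategy (equivalently, the previous player can force a win). *)

theory Defs
  imports Main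
begin

text \<open>Two-player games under the normal play convention, given by a move relation \<open>mv\<close>.
  A finite play from \<open>p\<close> is the list of positions visited, starting with \<open>p\<close>; the player about
  to move in \<open>p\<close> (the first player) moves from the entries with even index.\<close>

definition is_play :: "('p \<Rightarrow> 'p \<Rightarrow> bool) \<Rightarrow> 'p \<Rightarrow> 'p list \<Rightarrow> bool" where
  "is_play mv p h \<longleftrightarrow> h \<noteq> [] \<and> hd h = p \<and> successively mv h"

definition complete_play :: "('p \<Rightarrow> 'p \<Rightarrow> bool) \<Rightarrow> 'p \<Rightarrow> 'p list \<Rightarrow> bool" where
  "complete_play mv p h \<longleftrightarrow> is_play mv p h \<and> (\<nexists>q. mv (last h) q)"

text \<open>A strategy maps the history of the play so far to the position moved to.\<close>

definition legal_strategy :: "('p \<Rightarrow> 'p \<Rightarrow> bool) \<Rightarrow> 'p \<Rightarrow> ('p list \<Rightarrow> 'p) \<Rightarrow> bool" where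
  "legal_strategy mv p s \<longleftrightarrow>
     (\<forall>h. is_play mv p h \<and> odd (length h) \<and> (\<exists>q. mv (last h) q) \<longrightarrow> mv (last h) (s h))"

definition follows :: "('p list \<Rightarrow> 'p) \<Rightarrow> 'p list \<Rightarrow> bool" where
  "follows s h \<longleftrightarrow> (\<forall>k. even k \<and> Suc k < length h \<longrightarrow> h ! Suc k = s (take (Suc k) h))"

text \<open>A complete play is lost by the player to move at its end, so the first player wins it iff
  it has an odd number of moves, i.e. an even number of positions. The last conjunct says that
  an infinite play does not count as a win.\<close>

definition winning_strategy :: "('p \<Rightarrow> 'p \<Rightarrow> bool) \<Rightarrow> 'p \<Rightarrow> ('p list \<Rightarrow> 'p) \<Rightarrow> bool" where
  "winning_strategy mv p s \<longleftrightarrow>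
     legal_strategy mv p s \<and>
     (\<forall>h. complete_play mv p h \<and> follows s h \<longrightarrow> even (length h)) \<and>
     (\<nexists>f :: nat \<Rightarrow> 'p. \<forall>k. is_play mv p (map f [0..<Suc k]) \<and> follows s (map f [0..<Suc k]))"

definition nim_position :: "nat \<Rightarrow> nat list \<Rightarrow> bool" where
  "nim_position n z \<longleftrightarrow> length z = n \<and> (\<forall>x\<in>set z. 0 < x)"

text \<open>The index \<open>i\<close> is that of the heap which is kept and split.\<close>

definition nim_move :: "nat \<Rightarrow> nat list \<Rightarrow> nat list \<Rightarrow> bool" where
  "nim_move n z w \<longleftrightarrow> nim_position n z \<and> nim_position n w \<and> (\<exists>i<n. sum_list w = z ! i)"

definition P_position :: "nat \<Rightarrow> nat list \<Rightarrow> bool" where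
  "P_position n z \<longleftrightarrow> nim_position n z \<and> (\<nexists>s. winning_strategy (nim_move n) z s)"

end

theory Submission imports Defs begin

text \<open>Put \<open>m = n(n - 1)\<close> and call a heap good if its residue modulo \<open>m\<close> lies in \<open>{1..n - 1}\<close>.
  The residues of \<open>n\<close> good heaps add up to a number in \<open>{n..m}\<close>, so their total is never good.
  Conversely, a heap that is not good has the form \<open>qm + r\<close> with \<open>n \<le> r \<le> m\<close>; distributing \<open>r\<close>
  over \<open>n\<close> parts in \<open>{1..n - 1}\<close> and adding \<open>qm\<close> to one of them splits it into good heaps.
  Hence the all-good positions form the kernel of a terminating game.\<close>

lemma is_play_nth_mv:
  assumes "is_play mv p h" "Suc k < length h"
  shows "mv (h ! k) (h ! Suc k)"
  using assms unfolding is_play_def by (simp add: successively_conv_nth)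

lemma is_play_append:
  assumes "is_play mv p h" "mv (last h) q"
  shows "is_play mv p (h @ [q])"
  using assms unfolding is_play_def by (auto simp: successively_append_iff)

text \<open>Always answering an \<open>N\<close>-position by a move into \<open>G\<close> keeps the
  first player's turns in \<open>N\<close>. Every \<open>N\<close>-position has a move, so the first
  player is never stuck, and well-foundedness excludes infinite plays.\<close>

lemma winning_strategy_from_complement:
  assumes wf: "wfp (\<lambda>q p. mv p q)"
    and G_to_N: "\<And>p q. G p \<Longrightarrow> mv p q \<Longrightarrow> N q"
    and N_to_G: "\<And>p. N p \<Longrightarrow> \<exists>q. mv p q \<and> G q"
    and p: "N p"
  shows "\<exists>s. winning_strategy mv p s"
proof -
  define s where
    \<comment> \<open>Legality is demanded on all histories, including those that deviate from
      \<open>s\<close> and may leave \<open>N\<close>; the second branch supplies an arbitrary legal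
      move there.\<close>
    "s h = (if N (last h) then SOME q. mv (last h) q \<and> G q else SOME q. mv (last h) q)" for h
  have s_N: "mv (last h) (s h) \<and> G (s h)" if "N (last h)" for h
    using someI_ex[OF N_to_G[OF that]] that by (simp add: s_def)
  have s_mv: "mv (last h) (s h)" if "\<exists>q. mv (last h) q" for h
    using s_N[of h] someI_ex[OF that] by (cases "N (last h)") (auto simp: s_def)
  have inv: "if even k then N (h ! k) else G (h ! k)"
    if h: "is_play mv p h" "follows s h" "k < length h" for h k
    using h(3)
  proof (induction k)
    case 0
    then show ?case using p h(1) by (simp add: is_play_def hd_conv_nth)
  next
    case (Suc k)
    note mv = is_play_nth_mv[OF h(1) Suc.prems]
    show ?case
    proof (cases "even k")
      case True
      have "last (take (Suc k) h) = h ! k"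
        using Suc.prems by (simp add: take_Suc_conv_app_nth)
      moreover have "N (h ! k)" using Suc True by simp
      moreover have "h ! Suc k = s (take (Suc k) h)"
        using h(2) True Suc.prems by (simp add: follows_def)
      ultimately show ?thesis using s_N[of "take (Suc k) h"] True by simp
    next
      case False
      then show ?thesis using Suc mv G_to_N by simp
    qed
  qed
  have "winning_strategy mv p s"
    unfolding winning_strategy_def
  proof (intro conjI allI impI)
    show "legal_strategy mv p s"
      using s_mv by (simp add: legal_strategy_def)
  next
    fix h assume h: "complete_play mv p h \<and> follows s h"
    then have ne: "h \<noteq> []" and play: "is_play mv p h"
      by (auto simp: complete_play_def is_play_def)
    show "even (length h)"
    proof (rule ccontr)
      assume odd: "odd (length h)"
      \<comment> \<open>The last entry has index \<open>length h - 1\<close>, so the invariant would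
        put a position without moves into \<open>N\<close>.\<close>
      then have "even (length h - 1)" by simp
      with inv[OF play, of "length h - 1"] h ne have "N (last h)"
        by (simp add: last_conv_nth)
      with N_to_G h show False unfolding complete_play_def by blast
    qed
  next
    show "\<nexists>f. \<forall>k. is_play mv p (map f [0..<Suc k]) \<and> follows s (map f [0..<Suc k])"
    proof
      assume "\<exists>f. \<forall>k. is_play mv p (map f [0..<Suc k]) \<and> follows s (map f [0..<Suc k])"
      then obtain f where f: "\<And>k. is_play mv p (map f [0..<Suc k])" by blast
      have "mv (f k) (f (Suc k))" for k
        using is_play_nth_mv[OF f[of "Suc k"], of k] by (simp del: upt_Suc)
      with wf show False
        unfolding wfp_def wf_iff_no_infinite_down_chain by blast
    qed
  qed
  then show ?thesis by blast
qed

text \<open>The opponent refutes any \<open>s\<close> by moving back into \<open>G\<close> after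
  each of its moves. By termination some play following \<open>s\<close> gets stuck in
  \<open>G\<close> with the first player to move.\<close>

lemma no_winning_strategy_from_kernel:
  assumes wf: "wfp (\<lambda>q p. mv p q)"
    and G_to_N: "\<And>p q. G p \<Longrightarrow> mv p q \<Longrightarrow> N q"
    and N_to_G: "\<And>p. N p \<Longrightarrow> \<exists>q. mv p q \<and> G q"
    and p: "G p"
  shows "\<nexists>s. winning_strategy mv p s"
proof
  assume "\<exists>s. winning_strategy mv p s"
  then obtain s where legal: "legal_strategy mv p s"
    and win: "\<And>h. complete_play mv p h \<Longrightarrow> follows s h \<Longrightarrow> even (length h)"
    unfolding winning_strategy_def by blast
  have False if "is_play mv p h" "follows s h" "odd (length h)" "last h = x" "G x" for h x
    \<comment> \<open>One round consists of two moves, so the induction runs over the transitive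
      closure. The history is generalized because \<open>s\<close> depends on all of it.\<close>
    using wfp_tranclp[OF wf] that
  proof (induction x arbitrary: h rule: wfp_induct_rule)
    case (less x)
    show False
    proof (cases "\<exists>q. mv (last h) q")
      case False
      then show False using win[of h] less.prems by (simp add: complete_play_def)
    next
      case True
      define q where "q = s h"
      have q: "mv x q"
        using legal True less.prems by (auto simp: legal_strategy_def q_def)
      from G_to_N[OF less.prems(5) q] N_to_G obtain r where r: "mv q r" "G r" by blast
      have hqr: "is_play mv p (h @ [q, r])"
        using is_play_append[OF is_play_append[OF less.prems(1)], of q r] q r less.prems by simp
      have "follows s (h @ [q, r])"
        unfolding follows_def
      proof (intro allI impI)
        fix k assume k: "even k \<and> Suc k < length (h @ [q, r])"
        \<comment> \<open>The reply \<open>r\<close> has even index \<open>length h + 1\<close>, so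
          it is the opponent's choice and \<open>follows\<close> does not constrain it.\<close>
        have "Suc k \<noteq> Suc (length h)" using k less.prems(3) by auto
        then consider "Suc k < length h" | "Suc k = length h" using k by fastforce
        then show "(h @ [q, r]) ! Suc k = s (take (Suc k) (h @ [q, r]))"
        proof cases
          case 1
          then show ?thesis using less.prems(2) k by (simp add: follows_def nth_append)
        next
          case 2
          then show ?thesis by (simp add: q_def nth_append)
        qed
      qed
      moreover have "(\<lambda>q p. mv p q)\<^sup>+\<^sup>+ r x"
        using q r(1) by (meson tranclp.intros)
      ultimately show False
        using less.IH[of r "h @ [q, r]"] hqr r(2) less.prems(3) by simp
    qed
  qed
  from this[of "[p]" p] p show False
    by (simp add: is_play_def follows_def)
qed

lemma split_into_bounded_parts:
  fixes r k b :: nat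
  assumes "k \<le> r" "r \<le> k * b"
  shows "\<exists>w. length w = k \<and> (\<forall>x\<in>set w. 1 \<le> x \<and> x \<le> b) \<and> sum_list w = r"
  using assms
proof (induction k arbitrary: r)
  case 0
  then show ?case by simp
next
  case (Suc k)
  \<comment> \<open>Greedy choice: the largest part that still leaves one token for each of the
    \<open>k\<close> others. The remainder is \<open>r - b\<close> or exactly \<open>k\<close>, and
    either is at most \<open>k * b\<close>.\<close>
  define x where "x = min b (r - k)"
  have "1 \<le> b" using Suc.prems by (cases b) auto
  then have x: "1 \<le> x" "x \<le> b" "x \<le> r" using Suc.prems by (auto simp: x_def)
  have "k * 1 \<le> k * b" using \<open>1 \<le> b\<close> by (rule mult_le_mono2)
  then have "k \<le> r - x" "r - x \<le> k * b" using Suc.prems by (auto simp: x_def min_def)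
  from Suc.IH[OF this] obtain w
    where "length w = k" "\<forall>y\<in>set w. 1 \<le> y \<and> y \<le> b" "sum_list w = r - x" by blast
  with x show ?case by (intro exI[of _ "x # w"]) auto
qed

definition good_heap :: "nat \<Rightarrow> nat \<Rightarrow> bool" where
  "good_heap n x \<longleftrightarrow> 1 \<le> x mod (n * (n - 1)) \<and> x mod (n * (n - 1)) \<le> n - 1"

lemma sum_list_bounds:
  fixes f :: "'a \<Rightarrow> nat"
  assumes "\<forall>x\<in>set w. a \<le> f x \<and> f x \<le> b"
  shows "length w * a \<le> sum_list (map f w)" "sum_list (map f w) \<le> length w * b"
  using assms by (induction w) auto

lemma sum_list_mod_eq:
  fixes w :: "nat list"
  shows "sum_list (map (\<lambda>x. x mod m) w) mod m = sum_list w mod m"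
  by (induction w) (auto, metis mod_add_cong mod_mod_trivial)

text \<open>Read contrapositively, a good heap never splits into good heaps only, so no move joins
  two all-good positions.\<close>

lemma not_good_heap_sum_list:
  assumes n: "2 \<le> n" and w: "length w = n" "\<forall>x\<in>set w. good_heap n x"
  shows "\<not> good_heap n (sum_list w)"
proof -
  define m where "m = n * (n - 1)"
  define S where "S = sum_list (map (\<lambda>x. x mod m) w)"
  have "n * 1 \<le> S" "S \<le> m"
    using sum_list_bounds[of w 1 "\<lambda>x. x mod m" "n - 1"] w
    unfolding S_def m_def good_heap_def by auto
  \<comment> \<open>\<open>S\<close> is its own residue unless it attains the upper bound
    \<open>m\<close>, where the residue is 0.\<close>
  then have "S mod m = 0 \<or> n \<le> S mod m" by (cases "S = m") auto
  moreover have "S mod m = sum_list w mod m" unfolding S_def by (rule sum_list_mod_eq)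
  ultimately show ?thesis using n unfolding good_heap_def m_def by auto
qed

lemma split_bad_heap:
  assumes n: "2 \<le> n" and x: "0 < x" "\<not> good_heap n x"
  shows "\<exists>w. length w = n \<and> (\<forall>y\<in>set w. 0 < y \<and> good_heap n y) \<and> sum_list w = x"
proof -
  define m where "m = n * (n - 1)"
  have nm: "n \<le> m" "n - 1 < m" using n by (auto simp: m_def)
  \<comment> \<open>The representative is taken up to \<open>m\<close> instead of below it: residue
    0 becomes \<open>r = m\<close>, borrowing one from the quotient, which is positive because
    \<open>x\<close> is.\<close>
  obtain q r where qr: "x = q * m + r" "n \<le> r" "r \<le> m"
  proof (cases "x mod m = 0")
    case True
    then obtain q where q: "x = m * q" by auto
    with x have "x = (q - 1) * m + m" by (cases q) auto
    then show thesis using that nm by blast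
  next
    case False
    then have "n \<le> x mod m" using x(2) unfolding good_heap_def m_def by auto
    moreover have "x mod m \<le> m" using nm by (simp add: less_imp_le)
    ultimately show thesis using that[of "x div m" "x mod m"] by simp
  qed
  from split_into_bounded_parts[of n r "n - 1"] qr obtain w
    where w: "length w = n" "\<forall>y\<in>set w. 1 \<le> y \<and> y \<le> n - 1" "sum_list w = r"
    unfolding m_def by blast
  then obtain y v where yv: "w = y # v" using n by (cases w) auto
  \<comment> \<open>Used with the actual \<open>q\<close> for the enlarged first part and with 0 for
    the untouched parts in \<open>v\<close>.\<close>
  have small: "good_heap n (q * m + y)" "0 < q * m + y" if "1 \<le> y" "y \<le> n - 1" for y q
    using that nm unfolding good_heap_def m_def[symmetric] by auto
  show ?thesis
    using w small[of y q] small[of _ 0] qr(1) unfolding yv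
    by (intro exI[of _ "(q * m + y) # v"]) auto
qed

text \<open>The new total is a single old heap, and since \<open>2 \<le> n\<close> at least one
  other positive heap was deleted, so the total drops.\<close>

lemma wfp_nim_move:
  assumes "2 \<le> n"
  shows "wfp (\<lambda>w z. nim_move n z w)"
proof (rule wfp_if_convertible_to_nat[where f = sum_list])
  fix w z assume "nim_move n z w"
  then obtain i where z: "length z = n" "\<forall>x\<in>set z. 0 < x" and i: "i < n" "sum_list w = z ! i"
    by (auto simp: nim_move_def nim_position_def)
  have "z = take i z @ z ! i # drop (Suc i) z" using z i by (simp add: id_take_nth_drop)
  then have sum: "sum_list z = sum_list (take i z) + z ! i + sum_list (drop (Suc i) z)"
    by (metis add.assoc sum_list.Cons sum_list_append)
  have "take i z \<noteq> [] \<or> drop (Suc i) z \<noteq> []" using assms z i by auto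
  moreover have "0 < sum_list v" if "v \<noteq> []" "set v \<subseteq> set z" for v
    using that z(2) by (cases v) auto
  ultimately have "0 < sum_list (take i z) \<or> 0 < sum_list (drop (Suc i) z)"
    by (meson set_drop_subset set_take_subset)
  then show "sum_list w < sum_list z" using sum i by auto
qed

theorem theorem3p2:
  fixes n :: nat and z :: "nat list"
  assumes "n \<ge> 2" and "nim_position n z"
  shows "P_position n z \<longleftrightarrow>
    (\<forall>i<n. 1 \<le> z ! i mod (n * (n - 1)) \<and> z ! i mod (n * (n - 1)) \<le> n - 1)"
proof -
  define G where "G z \<longleftrightarrow> nim_position n z \<and> (\<forall>x\<in>set z. good_heap n x)" for z
  define N where "N z \<longleftrightarrow> nim_position n z \<and> \<not> (\<forall>x\<in>set z. good_heap n x)" for z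
  have G_to_N: "N w" if "G z" "nim_move n z w" for z w
  proof -
    from that obtain i where "i < length z" "sum_list w = z ! i" and w: "nim_position n w"
      by (auto simp: nim_move_def nim_position_def)
    then have "good_heap n (sum_list w)" using that(1) by (simp add: G_def)
    with not_good_heap_sum_list[OF assms(1), of w] w show ?thesis
      by (auto simp: N_def nim_position_def)
  qed
  have N_to_G: "\<exists>w. nim_move n z w \<and> G w" if N: "N z" for z
  proof -
    \<comment> \<open>Any heap that is not good can be the one kept; its splitting determines the
      whole new position.\<close>
    from N obtain i where i: "i < n" "\<not> good_heap n (z ! i)" "0 < z ! i"
      by (auto simp: N_def nim_position_def all_set_conv_all_nth)
    from split_bad_heap[OF assms(1) i(3,2)] obtain w
      where "length w = n" "\<forall>y\<in>set w. 0 < y \<and> good_heap n y" "sum_list w = z ! i" by blast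
    then show ?thesis
      using N i(1) by (intro exI[of _ w]) (auto simp: G_def N_def nim_move_def nim_position_def)
  qed
  note wf = wfp_nim_move[OF assms(1)]
  have "P_position n z \<longleftrightarrow> G z"
  proof (cases "G z")
    case True
    have "\<nexists>s. winning_strategy (nim_move n) z s"
      by (rule no_winning_strategy_from_kernel[where G = G and N = N])
        (fact wf G_to_N N_to_G True)+
    with True assms(2) show ?thesis by (simp add: P_position_def)
  next
    case False
    then have z: "N z" using assms(2) by (simp add: G_def N_def)
    have "\<exists>s. winning_strategy (nim_move n) z s"
      by (rule winning_strategy_from_complement[where G = G and N = N])
        (fact wf G_to_N N_to_G z)+
    with False show ?thesis by (simp add: P_position_def)
  qed
  also have "G z \<longleftrightarrow> (\<forall>i<n. good_heap n (z ! i))"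
    using assms(2) by (auto simp: G_def nim_position_def all_set_conv_all_nth)
  finally show ?thesis unfolding good_heap_def .
qed

end
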